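(* Let $\mathbb{E}_1,\mathbb{E}_2$ be Euclidean spaces, let $w_1,\dots,w_l\in\mathbb{E}_2\setminus\{0\}$ and let $P=\bigcap_{i=1}^l H_i$ with $H_i=\{x\in\mathbb{E}_2 : \langle w_i,x\rangle\ge 0\}$. Then for $F:D\to\mathbb{E}_2$ with $D\subset\mathbb{E}_1$ nonempty and convex we have: (a) $F$ is $P$-convex if and only if $\langle w_i,F\rangle$ is convex for all $i=1,\dots,l$. (b) $F$ is $P$-closed if $\langle w_i,F\rangle$ is lower semicontinuous for all $i=1,\dots,l$.
   Context: A Euclidean space is a finite-dimensional real inner product space. For a cone $K\subset\mathbb{E}_2$ (a nonempty set closed under multiplication by all $\lambda\ge0$) and $F:D\to\mathbb{E}_2$, the $K$-epigraph is $K\text{-}\mathrm{epi}\,F:=\{(x,y)\in D\times\mathbb{E}_2 : y-F(x)\in K\}$; $F$ is $K$-convex if $K\text{-}\mathrm{epi}\,F$ is convex, and $K$-closed if $K\text{-}\mathrm{epi}\,F$ is closed in $\mathbb{E}_1\times\mathbb{E}_2$. For $u\in\mathbb{E}_2$ the scalarization $\langle u,F\rangle:\mathbb{E}_1\to\mathbb{R}\cup\{+\infty\}$ is $\langle u,F\rangle(x)=\langle u,F(x)\rangle$ for $x\in D$ and $+\infty$ for $x\notin D$; convexity and lower semicontinuity are those of this extended-real-valued function on all of $\mathbb{E}_1$. *)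

theory Defs
  imports "HOL-Analysis.Analysis"
begin

text \<open>
  A map \<open>F : D \<rightarrow> E\<^sub>2\<close> with \<open>D \<subseteq> E\<^sub>1\<close> is given by its domain \<open>D\<close> and a total function \<open>F\<close>
  whose values outside \<open>D\<close> are never used.
\<close>

definition cone_epi :: "'b::ab_group_add set \<Rightarrow> 'a set \<Rightarrow> ('a \<Rightarrow> 'b) \<Rightarrow> ('a \<times> 'b) set"
  where "cone_epi K D F = {(x, y). x \<in> D \<and> y - F x \<in> K}"

definition cone_convex :: "'b::real_vector set \<Rightarrow> 'a::real_vector set \<Rightarrow> ('a \<Rightarrow> 'b) \<Rightarrow> bool"
  where "cone_convex K D F \<longleftrightarrow> convex (cone_epi K D F)"

definition cone_closed ::
    "'b::real_normed_vector set \<Rightarrow> 'a::topological_space set \<Rightarrow> ('a \<Rightarrow> 'b) \<Rightarrow> bool"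
  where "cone_closed K D F \<longleftrightarrow> closed (cone_epi K D F)"

definition scalarization :: "'b::real_inner \<Rightarrow> 'a set \<Rightarrow> ('a \<Rightarrow> 'b) \<Rightarrow> 'a \<Rightarrow> ereal"
  where "scalarization u D F x = (if x \<in> D then ereal (u \<bullet> F x) else \<infinity>)"

text \<open>
  The library's \<^const>\<open>convex_on\<close> is for real-valued functions only. Restricting to \<open>0 < t < 1\<close>
  avoids products of \<open>0\<close> and \<open>\<infinity>\<close>.
\<close>

definition ereal_convex :: "('a::real_vector \<Rightarrow> ereal) \<Rightarrow> bool"
  where "ereal_convex f \<longleftrightarrow>
    (\<forall>x y. \<forall>t. 0 < t \<and> t < 1 \<longrightarrow>
      f ((1 - t) *\<^sub>R x + t *\<^sub>R y) \<le> ereal (1 - t) * f x + ereal t * f y)"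

text \<open>The filter \<open>at x\<close> is punctured; including \<open>x\<close> itself would not change the condition.\<close>

definition lower_semicont :: "('a::topological_space \<Rightarrow> ereal) \<Rightarrow> bool"
  where "lower_semicont f \<longleftrightarrow> (\<forall>x. f x \<le> Liminf (at x) f)"

end

theory Submission
  imports Defs
begin

text \<open>
  Membership of \<open>(x, y)\<close> in the \<open>P\<close>-epigraph means that \<open>x \<in> D\<close> and \<open>w\<^sub>i \<bullet> F x \<le> w\<^sub>i \<bullet> y\<close> for
  every \<open>i\<close>. So the \<open>P\<close>-epigraph is the intersection over \<open>i\<close> of the preimages of the ordinary
  epigraphs of the scalarizations under the continuous linear maps \<open>(x, y) \<mapsto> (x, w\<^sub>i \<bullet> y)\<close>. Both
  convexity and closedness survive preimages under such maps and intersections. Convex functions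
  have convex epigraphs, so scalar convexity implies \<open>P\<close>-convexity
  (\<open>cone_convex_halfspaces_iff\<close>); lower semicontinuous functions have closed epigraphs
  (\<open>lower_semicont_closed_le\<close>), which gives part (b).

  The converse in part (a) comes from the graph: since \<open>0 \<in> P\<close>, the points \<open>(x, F x)\<close> lie in the
  \<open>P\<close>-epigraph, and membership of a convex combination of two of them is exactly the convexity
  inequality of every scalarization.

  Part (b) has no such converse, because the other inequalities may close up an epigraph that a
  single one leaves open. On the real line, let \<open>F x = (-1, 1 / \<bar>x\<bar>)\<close> for \<open>x \<noteq> 0\<close> and \<open>F 0 = (0, 0)\<close>,
  and let \<open>P\<close> be the nonnegative quadrant. The first component is not lower semicontinuous at \<open>0\<close>,
  but the second one tends to \<open>\<infinity>\<close> there, so the \<open>P\<close>-epigraph is closed.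
\<close>

lemma ereal_convex_scalarization_iff:
  fixes F :: "'a::real_vector \<Rightarrow> 'b::real_inner"
  assumes "convex D"
  shows "ereal_convex (scalarization u D F) \<longleftrightarrow> convex_on D (\<lambda>x. u \<bullet> F x)"
proof
  assume conv: "ereal_convex (scalarization u D F)"
  show "convex_on D (\<lambda>x. u \<bullet> F x)"
  proof (rule convex_onI)
    fix t :: real and x y assume t: "0 < t" "t < 1" and xy: "x \<in> D" "y \<in> D"
    have "(1 - t) *\<^sub>R x + t *\<^sub>R y \<in> D"
      using assms t xy by (auto simp: convex_alt)
    moreover have "scalarization u D F ((1 - t) *\<^sub>R x + t *\<^sub>R y)
        \<le> ereal (1 - t) * scalarization u D F x + ereal t * scalarization u D F y"
      using conv t by (simp add: ereal_convex_def)
    ultimately show "u \<bullet> F ((1 - t) *\<^sub>R x + t *\<^sub>R y) \<le> (1 - t) * (u \<bullet> F x) + t * (u \<bullet> F y)"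
      using xy by (simp add: scalarization_def)
  qed (rule assms)
next
  assume conv: "convex_on D (\<lambda>x. u \<bullet> F x)"
  show "ereal_convex (scalarization u D F)"
    unfolding ereal_convex_def
  proof (intro allI impI)
    fix x y and t :: real assume t: "0 < t \<and> t < 1"
    show "scalarization u D F ((1 - t) *\<^sub>R x + t *\<^sub>R y)
        \<le> ereal (1 - t) * scalarization u D F x + ereal t * scalarization u D F y"
    proof (cases "x \<in> D \<and> y \<in> D")
      case True
      then have "(1 - t) *\<^sub>R x + t *\<^sub>R y \<in> D"
        using assms t by (auto simp: convex_alt)
      with True t show ?thesis
        using convex_onD[OF conv, of t x y] by (simp add: scalarization_def)
    next
      case False
      \<comment> \<open>Both weights are positive, so an argument outside \<open>D\<close> makes the right-hand side \<open>\<infinity>\<close>.\<close>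
      with t show ?thesis by (auto simp: scalarization_def)
    qed
  qed
qed

lemma cone_epi_halfspaces_eq:
  fixes F :: "'a \<Rightarrow> 'b::real_inner"
  shows "cone_epi (\<Inter>i\<in>I. {y. w i \<bullet> y \<ge> 0}) D F
    = {(x, y). x \<in> D \<and> (\<forall>i\<in>I. w i \<bullet> F x \<le> w i \<bullet> y)}"
  by (auto simp: cone_epi_def inner_diff_right)

lemma cone_convex_halfspaces_iff:
  fixes F :: "'a::real_vector \<Rightarrow> 'b::real_inner"
  assumes "convex D"
  shows "cone_convex (\<Inter>i\<in>I. {y. w i \<bullet> y \<ge> 0}) D F \<longleftrightarrow> (\<forall>i\<in>I. convex_on D (\<lambda>x. w i \<bullet> F x))"
    (is "cone_convex ?P D F \<longleftrightarrow> _")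
proof
  assume conv: "cone_convex ?P D F"
  show "\<forall>i\<in>I. convex_on D (\<lambda>x. w i \<bullet> F x)"
  proof (intro ballI convex_onI)
    fix i x y and t :: real assume i: "i \<in> I" and t: "0 < t" "t < 1" and xy: "x \<in> D" "y \<in> D"
    have "(x, F x) \<in> cone_epi ?P D F" "(y, F y) \<in> cone_epi ?P D F"
      using xy by (auto simp: cone_epi_def)
    then have "(1 - t) *\<^sub>R (x, F x) + t *\<^sub>R (y, F y) \<in> cone_epi ?P D F"
      using conv t unfolding cone_convex_def convex_alt by (meson less_imp_le)
    then show "w i \<bullet> F ((1 - t) *\<^sub>R x + t *\<^sub>R y) \<le> (1 - t) * (w i \<bullet> F x) + t * (w i \<bullet> F y)"
      using i by (simp add: cone_epi_halfspaces_eq inner_add_right)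
  qed (rule assms)
next
  assume conv: "\<forall>i\<in>I. convex_on D (\<lambda>x. w i \<bullet> F x)"
  have "cone_epi ?P D F = D \<times> UNIV \<inter>
      (\<Inter>i\<in>I. (\<lambda>p. (fst p, w i \<bullet> snd p)) -` epigraph D (\<lambda>x. w i \<bullet> F x))"
    by (auto simp: cone_epi_halfspaces_eq epigraph_def)
  moreover have "linear (\<lambda>p::'a \<times> 'b. (fst p, w i \<bullet> snd p))" for i
    by (rule linearI) (auto simp: inner_add_right)
  ultimately show "cone_convex ?P D F"
    using conv assms unfolding cone_convex_def
    by (auto intro!: convex_Int convex_Times convex_INT convex_linear_vimage convex_epigraphI)
qed

lemma lower_semicont_open_superlevel:
  assumes "lower_semicont f"
  shows "open {x. c < f x}"
proof (subst open_subopen, intro ballI)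
  fix x assume x: "x \<in> {x. c < f x}"
  then have "c < Liminf (at x) f"
    using assms by (auto simp: lower_semicont_def intro: less_le_trans)
  then have "eventually (\<lambda>z. c < f z) (at x)"
    by (rule less_LiminfD)
  then obtain U where "open U" "x \<in> U" "\<forall>z\<in>U. z \<noteq> x \<longrightarrow> c < f z"
    by (auto simp: eventually_at_topological)
  with x show "\<exists>T. open T \<and> x \<in> T \<and> T \<subseteq> {x. c < f x}"
    by (intro exI[of _ U]) auto
qed

text \<open>
  A strict inequality \<open>g y < f x\<close> is witnessed by a level strictly in between, so the complement
  is a union of open rectangles.
\<close>

lemma lower_semicont_closed_le:
  fixes f :: "'a::topological_space \<Rightarrow> ereal" and g :: "'b::topological_space \<Rightarrow> real"
  assumes "lower_semicont f" and "continuous_on UNIV g"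
  shows "closed {(x, y). f x \<le> ereal (g y)}"
proof -
  have "- {(x, y). f x \<le> ereal (g y)} = (\<Union>c. {x. ereal c < f x} \<times> {y. g y < c})"
  proof (intro equalityI subsetI)
    fix p assume "p \<in> - {(x, y). f x \<le> ereal (g y)}"
    then obtain x y where p: "p = (x, y)" and "ereal (g y) < f x"
      by (cases p) auto
    then obtain c where "ereal (g y) < ereal c" "ereal c < f x"
      using ereal_dense2 by blast
    then show "p \<in> (\<Union>c. {x. ereal c < f x} \<times> {y. g y < c})"
      by (auto simp: p)
  next
    fix p assume "p \<in> (\<Union>c. {x. ereal c < f x} \<times> {y. g y < c})"
    then obtain x y c where p: "p = (x, y)" and "ereal c < f x" "ereal (g y) < ereal c"
      by auto
    then have "ereal (g y) < f x" by (blast intro: less_trans)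
    then show "p \<in> - {(x, y). f x \<le> ereal (g y)}" by (simp add: p)
  qed
  moreover have "open (\<Union>c. {x. ereal c < f x} \<times> {y. g y < c})"
    using assms
    by (intro open_UN ballI open_Times lower_semicont_open_superlevel open_Collect_less) auto
  ultimately show ?thesis by (simp add: closed_def)
qed

text \<open>
  The index set must be nonempty: the value \<open>\<infinity>\<close> of a scalarization outside \<open>D\<close> is what encodes
  the condition \<open>x \<in> D\<close>. For the empty family the epigraph is \<open>D \<times> UNIV\<close>, which need not be closed.
\<close>

lemma cone_closed_halfspaces:
  fixes F :: "'a::topological_space \<Rightarrow> 'b::real_inner"
  assumes "I \<noteq> {}" and "\<And>i. i \<in> I \<Longrightarrow> lower_semicont (scalarization (w i) D F)"
  shows "cone_closed (\<Inter>i\<in>I. {y. w i \<bullet> y \<ge> 0}) D F"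
proof -
  have "cone_epi (\<Inter>i\<in>I. {y. w i \<bullet> y \<ge> 0}) D F
      = (\<Inter>i\<in>I. {(x, y). scalarization (w i) D F x \<le> ereal (w i \<bullet> y)})"
    using assms(1) by (auto simp: cone_epi_halfspaces_eq scalarization_def split: if_splits)
  moreover have "closed (\<Inter>i\<in>I. {(x, y). scalarization (w i) D F x \<le> ereal (w i \<bullet> y)})"
    using assms(2) by (intro closed_INT ballI lower_semicont_closed_le) (auto intro: continuous_intros)
  ultimately show ?thesis by (simp add: cone_closed_def)
qed

theorem corollary23:
  fixes D :: "'a::real_inner set"
    and F :: "'a \<Rightarrow> 'b::real_inner"
    and w :: "nat \<Rightarrow> 'b"
    and l :: nat
    and P :: "'b set"
  assumes fin_dim_E1: "\<exists>B :: 'a set. finite B \<and> span B = UNIV"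
    and fin_dim_E2: "\<exists>B :: 'b set. finite B \<and> span B = UNIV"
    and l_pos: "l \<ge> 1"
    and w_nonzero: "\<forall>i\<in>{1..l}. w i \<noteq> 0"
    and P_eq: "P = (\<Inter>i\<in>{1..l}. {x. w i \<bullet> x \<ge> 0})"
    and D_nonempty: "D \<noteq> {}"
    and D_convex: "convex D"
  shows "(cone_convex P D F \<longleftrightarrow> (\<forall>i\<in>{1..l}. ereal_convex (scalarization (w i) D F))) \<and>
    ((\<forall>i\<in>{1..l}. lower_semicont (scalarization (w i) D F)) \<longrightarrow> cone_closed P D F)"
  using cone_convex_halfspaces_iff[OF D_convex, of w "{1..l}" F]
    ereal_convex_scalarization_iff[OF D_convex] cone_closed_halfspaces[of "{1..l}" w D F] l_pos
  unfolding P_eq by auto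

end
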